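(* Let $X,Y$ be finite sets. For every function $f:X\times Y\to\{0,1\}$, $$Q_1^*(f)\;\geq\;\tfrac14\log_2 \mathrm{fool}^1(f)-\tfrac12 .$$
   Context: Fooling sets. A 1-fooling set for $f$ is a set $F\subseteq X\times Y$ such that (1) $f(x,y)=1$ for all $(x,y)\in F$, and (2) for any two distinct $(x,y),(x',y')\in F$, $f(x,y')=0$ or $f(x',y)=0$. $\mathrm{fool}^1(f)$ is the maximal size of a 1-fooling set for $f$ (if it is $0$, read $\log_2 0=-\infty$, so the bound is trivial). Quantum protocols with prior entanglement. Alice receives $x\in X$, Bob receives $y\in Y$. A $q$-qubit protocol ($q\ge 1$) starts in a fixed state (independent of the inputs) on finite-dimensional registers, some held by Alice and the others by Bob; this state may be arbitrarily entangled between them and may include local ancillas of any finite dimension. There are $q$ rounds. In round $t$, a designated sender (depending only on $t$) applies a unitary, depending on $t$ and on the sender's own input, to all registers the sender currently holds, and then transfers one designated qubit to the other party. The output is the result of measuring the last transferred qubit in the computational basis. One-sided-error complexity. $Q_1^*(f)$ is the minimal $q$ for which some $q$-qubit protocol with prior entanglement outputs 1 with probability $0$ on every $(x,y)$ with $f(x,y)=0$, and outputs 1 with probability at least $1/2$ on every $(x,y)$ with $f(x,y)=1$. *)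

theory Defs
  imports "HOL-Analysis.Analysis"
begin

section \<open>Fooling sets\<close>

definition one_fooling_set :: "'x set \<Rightarrow> 'y set \<Rightarrow> ('x \<times> 'y \<Rightarrow> bool) \<Rightarrow> ('x \<times> 'y) set \<Rightarrow> bool" where
  "one_fooling_set X Y f F \<longleftrightarrow>
     F \<subseteq> X \<times> Y \<and>
     (\<forall>z\<in>F. f z) \<and>
     (\<forall>x y x' y'. (x, y) \<in> F \<longrightarrow> (x', y') \<in> F \<longrightarrow> (x, y) \<noteq> (x', y') \<longrightarrow>
        \<not> f (x, y') \<or> \<not> f (x', y))"

definition fool1 :: "'x set \<Rightarrow> 'y set \<Rightarrow> ('x \<times> 'y \<Rightarrow> bool) \<Rightarrow> nat" where
  "fool1 X Y f = Max (card ` {F. one_fooling_set X Y f F})"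

text \<open>The real logarithm of the library satisfies \<open>log 2 0 = 0\<close>; here the value is \<open>- \<infinity>\<close>.\<close>

definition log2_ereal :: "nat \<Rightarrow> ereal" where
  "log2_ereal n = (if n = 0 then - \<infinity> else ereal (log 2 (real n)))"


section \<open>Operators on finite-dimensional registers\<close>

text \<open>
  Registers are named by natural numbers, and register \<open>i\<close> has dimension \<open>d i\<close>. The computational
  basis of the tensor product of the registers in \<open>S\<close> consists of the assignments \<open>basis d S\<close>.
  A vector is its amplitude function, and only the values at basis assignments matter. An operator
  is its matrix, with \<open>U b a\<close> the entry in row \<open>b\<close> and column \<open>a\<close>.
\<close>

type_synonym assignment = "nat \<Rightarrow> nat"
type_synonym state = "assignment \<Rightarrow> complex"
type_synonym operator = "assignment \<Rightarrow> assignment \<Rightarrow> complex"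

definition basis :: "(nat \<Rightarrow> nat) \<Rightarrow> nat set \<Rightarrow> assignment set" where
  "basis d S = (\<Pi>\<^sub>E i\<in>S. {..<d i})"

definition unitary_op :: "(nat \<Rightarrow> nat) \<Rightarrow> nat set \<Rightarrow> operator \<Rightarrow> bool" where
  "unitary_op d S U \<longleftrightarrow>
     (\<forall>a\<in>basis d S. \<forall>b\<in>basis d S.
        (\<Sum>c\<in>basis d S. cnj (U c a) * U c b) = (if a = b then 1 else 0) \<and>
        (\<Sum>c\<in>basis d S. U a c * cnj (U b c)) = (if a = b then 1 else 0))"

text \<open>The operator \<open>U\<close> on the registers in \<open>S\<close>, tensored with the identity on all others.\<close>

definition apply_op :: "(nat \<Rightarrow> nat) \<Rightarrow> nat set \<Rightarrow> operator \<Rightarrow> state \<Rightarrow> state" where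
  "apply_op d S U \<psi> = (\<lambda>c. \<Sum>a\<in>basis d S. U (restrict c S) a * \<psi> (override_on c a S))"


section \<open>Quantum protocols with prior entanglement\<close>

datatype party = Alice | Bob

fun other :: "party \<Rightarrow> party" where
  "other Alice = Bob"
| "other Bob = Alice"

text \<open>
  The registers are \<open>0, \<dots>, reg_num P - 1\<close>, local ancillas included. Rounds are numbered from \<open>0\<close>;
  \<open>qubit P t\<close> is the register handed over at the end of round \<open>t\<close>.
\<close>

record ('x, 'y) protocol =
  reg_num :: nat
  reg_dim :: "nat \<Rightarrow> nat"
  init_owner :: "nat \<Rightarrow> party"
  init_state :: state
  sender :: "nat \<Rightarrow> party"
  qubit :: "nat \<Rightarrow> nat"
  alice_op :: "nat \<Rightarrow> 'x \<Rightarrow> operator"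
  bob_op :: "nat \<Rightarrow> 'y \<Rightarrow> operator"

fun owner :: "('x, 'y) protocol \<Rightarrow> nat \<Rightarrow> nat \<Rightarrow> party" where
  "owner P 0 = init_owner P"
| "owner P (Suc t) = (owner P t)(qubit P t := other (sender P t))"

definition held :: "('x, 'y) protocol \<Rightarrow> party \<Rightarrow> nat \<Rightarrow> nat set" where
  "held P p t = {i. i < reg_num P \<and> owner P t i = p}"

definition round_op :: "('x, 'y) protocol \<Rightarrow> 'x \<Rightarrow> 'y \<Rightarrow> nat \<Rightarrow> operator" where
  "round_op P x y t = (case sender P t of Alice \<Rightarrow> alice_op P t x | Bob \<Rightarrow> bob_op P t y)"

fun run :: "('x, 'y) protocol \<Rightarrow> 'x \<Rightarrow> 'y \<Rightarrow> nat \<Rightarrow> state" where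
  "run P x y 0 = init_state P"
| "run P x y (Suc t) =
     apply_op (reg_dim P) (held P (sender P t) t) (round_op P x y t) (run P x y t)"

definition qubit_protocol ::
    "'x set \<Rightarrow> 'y set \<Rightarrow> nat \<Rightarrow> ('x, 'y) protocol \<Rightarrow> bool" where
  "qubit_protocol X Y q P \<longleftrightarrow>
     q \<ge> 1 \<and>
     (\<Sum>c\<in>basis (reg_dim P) {..<reg_num P}. (cmod (init_state P c))\<^sup>2) = 1 \<and>
     (\<forall>t<q. qubit P t \<in> held P (sender P t) t \<and> reg_dim P (qubit P t) = 2) \<and>
     (\<forall>t<q. sender P t = Alice \<longrightarrow>
        (\<forall>x\<in>X. unitary_op (reg_dim P) (held P Alice t) (alice_op P t x))) \<and>
     (\<forall>t<q. sender P t = Bob \<longrightarrow>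
        (\<forall>y\<in>Y. unitary_op (reg_dim P) (held P Bob t) (bob_op P t y)))"

definition prob_output_1 :: "nat \<Rightarrow> ('x, 'y) protocol \<Rightarrow> 'x \<Rightarrow> 'y \<Rightarrow> real" where
  "prob_output_1 q P x y =
     (\<Sum>c\<in>{c \<in> basis (reg_dim P) {..<reg_num P}. c (qubit P (q - 1)) = 1}.
        (cmod (run P x y q c))\<^sup>2)"

definition one_sided_computes ::
    "'x set \<Rightarrow> 'y set \<Rightarrow> ('x \<times> 'y \<Rightarrow> bool) \<Rightarrow> nat \<Rightarrow> ('x, 'y) protocol \<Rightarrow> bool" where
  "one_sided_computes X Y f q P \<longleftrightarrow>
     (\<forall>x\<in>X. \<forall>y\<in>Y. \<not> f (x, y) \<longrightarrow> prob_output_1 q P x y = 0) \<and>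
     (\<forall>x\<in>X. \<forall>y\<in>Y. f (x, y) \<longrightarrow> prob_output_1 q P x y \<ge> 1 / 2)"

text \<open>A nonempty set of elements of \<open>enat\<close> has its infimum as minimum; the infimum of \<open>{}\<close> is \<open>\<infinity>\<close>.\<close>

definition Q1_star :: "'x set \<Rightarrow> 'y set \<Rightarrow> ('x \<times> 'y \<Rightarrow> bool) \<Rightarrow> enat" where
  "Q1_star X Y f =
     Inf (enat ` {q. \<exists>P. qubit_protocol X Y q P \<and> one_sided_computes X Y f q P})"

end

theory Submission
  imports Defs
begin

text \<open>
  Writing the final state as a sum over the values of the transferred qubits splits every
  amplitude into Alice's and Bob's contributions. If no input pair off the diagonal can be accepted,
  then Bob, holding Alice's half of this sum as a message, could test his inputs one after the
  other without disturbing the state; Gram--Schmidt makes these tests orthogonal, and Bessel's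
  inequality bounds their number by \<open>4 ^ q\<close> divided by the acceptance probability. A fooling
  set \<open>{(x\<^sub>i, y\<^sub>i)}\<close> is made diagonal by running two copies of the protocol with exchanged roles,
  on \<open>(x\<^sub>i, y\<^sub>j)\<close> and \<open>(x\<^sub>j, y\<^sub>i)\<close>: this uses \<open>2 * q\<close> qubits and accepts with probability at
  least \<open>1 / 4\<close> on the diagonal.
\<close>

section \<open>Inner products of complex vectors\<close>

definition cip :: "'k set \<Rightarrow> ('k \<Rightarrow> complex) \<Rightarrow> ('k \<Rightarrow> complex) \<Rightarrow> complex" where
  "cip K v w = (\<Sum>k\<in>K. cnj (v k) * w k)"

definition sqnorm :: "'k set \<Rightarrow> ('k \<Rightarrow> complex) \<Rightarrow> real" where
  "sqnorm K v = (\<Sum>k\<in>K. (cmod (v k))\<^sup>2)"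

lemma sqnorm_nonneg: "0 \<le> sqnorm K v"
  by (simp add: sqnorm_def sum_nonneg)

lemma cip_self: "cip K v v = of_real (sqnorm K v)"
  by (simp add: cip_def sqnorm_def complex_norm_square mult.commute del: of_real_power)

lemma cip_commute: "cip K w v = cnj (cip K v w)"
  by (simp add: cip_def mult.commute)

lemma cip_diff_right: "cip K u (\<lambda>k. v k - w k) = cip K u v - cip K u w"
  by (simp add: cip_def right_diff_distrib sum_subtractf)

lemma cip_sum_right: "cip K u (\<lambda>k. \<Sum>i\<in>I. a i * v i k) = (\<Sum>i\<in>I. a i * cip K u (v i))"
  by (simp add: cip_def sum_distrib_left sum.swap[of _ K I] algebra_simps)

lemma cip_scale_left: "cip K (\<lambda>k. a * v k) w = cnj a * cip K v w"
  by (simp add: cip_def sum_distrib_left algebra_simps)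

lemma sqnorm_scale: "sqnorm K (\<lambda>k. a * v k) = (cmod a)\<^sup>2 * sqnorm K v"
  by (simp add: sqnorm_def norm_mult power_mult_distrib sum_distrib_left)

section \<open>Orthonormal sets, orthogonal projection and Bessel's inequality\<close>

definition orthonormal :: "'k set \<Rightarrow> ('k \<Rightarrow> complex) set \<Rightarrow> bool" where
  "orthonormal K E \<longleftrightarrow> finite E \<and> (\<forall>e\<in>E. \<forall>e'\<in>E. cip K e e' = (if e = e' then 1 else 0))"

definition orth_proj :: "'k set \<Rightarrow> ('k \<Rightarrow> complex) set \<Rightarrow> ('k \<Rightarrow> complex) \<Rightarrow> 'k \<Rightarrow> complex" where
  "orth_proj K E v = (\<lambda>k. \<Sum>e\<in>E. cip K e v * e k)"

lemma cip_orth_proj: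
  assumes "orthonormal K E" "e \<in> E"
  shows "cip K e (orth_proj K E v) = cip K e v"
proof -
  have "cip K e (orth_proj K E v) = (\<Sum>e'\<in>E. cip K e' v * cip K e e')"
    by (simp add: orth_proj_def cip_sum_right)
  also have "\<dots> = (\<Sum>e'\<in>E. if e = e' then cip K e v else 0)"
    using assms by (intro sum.cong) (auto simp: orthonormal_def)
  finally show ?thesis using assms by (simp add: orthonormal_def)
qed

lemma cip_orth_proj_right:
  "cip K v (orth_proj K E v) = of_real (\<Sum>e\<in>E. (cmod (cip K e v))\<^sup>2)"
  unfolding orth_proj_def cip_sum_right
  by (subst cip_commute[of K v]) (simp add: complex_norm_square del: of_real_power)

lemma sqnorm_orth_proj:
  assumes "orthonormal K E"
  shows "sqnorm K (orth_proj K E v) = (\<Sum>e\<in>E. (cmod (cip K e v))\<^sup>2)"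
proof -
  let ?p = "orth_proj K E v"
  have "cip K ?p ?p = (\<Sum>e\<in>E. cip K e v * cip K ?p e)"
    by (subst (2) orth_proj_def) (rule cip_sum_right)
  also have "\<dots> = (\<Sum>e\<in>E. cip K e v * cnj (cip K e v))"
    using assms by (subst cip_commute) (simp add: cip_orth_proj)
  also have "\<dots> = of_real (\<Sum>e\<in>E. (cmod (cip K e v))\<^sup>2)"
    by (simp add: complex_norm_square del: of_real_power)
  finally show ?thesis unfolding cip_self of_real_eq_iff .
qed

text \<open>The residual \<open>d\<close> is orthogonal to the projection, so its squared norm is
  the difference of the two sides.\<close>

lemma Bessel:
  assumes "orthonormal K E"
  shows "(\<Sum>e\<in>E. (cmod (cip K e v))\<^sup>2) \<le> sqnorm K v"
proof -
  let ?p = "orth_proj K E v" and ?s = "\<Sum>e\<in>E. (cmod (cip K e v))\<^sup>2"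
  have pv: "cip K ?p v = of_real ?s"
    by (subst cip_commute) (simp only: cip_orth_proj_right complex_cnj_complex_of_real)
  define d where "d = (\<lambda>k. v k - ?p k)"
  have d: "cip K u d = cip K u v - cip K u ?p" for u
    unfolding d_def by (rule cip_diff_right)
  have "cip K ?p d = 0"
    by (simp only: d pv cip_self sqnorm_orth_proj[OF assms] diff_self)
  hence "cip K d ?p = 0"
    by (subst cip_commute) simp
  hence "cip K d d = cip K d v"
    by (simp add: d)
  also have "\<dots> = cnj (cip K v d)"
    by (rule cip_commute)
  also have "\<dots> = of_real (sqnorm K v - ?s)"
    by (simp only: d cip_self cip_orth_proj_right of_real_diff
        complex_cnj_diff complex_cnj_complex_of_real)
  finally have "sqnorm K d = sqnorm K v - ?s"
    unfolding cip_self of_real_eq_iff .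
  thus ?thesis using sqnorm_nonneg[of K d] by simp
qed

text \<open>Gram--Schmidt, with at most one new unit vector per element of \<open>R\<close>. The
  equivalence expresses that both families have the same orthogonal complement; what follows only
  asks which inner products vanish, so spans can be avoided.\<close>

lemma orthonormal_extend:
  assumes "orthonormal K E" "finite R"
  shows "\<exists>E'. E \<inter> E' = {} \<and> orthonormal K (E \<union> E') \<and>
           (\<forall>v. (\<forall>e\<in>E \<union> E'. cip K e v = 0) \<longleftrightarrow> (\<forall>g\<in>E \<union> R. cip K g v = 0))"
  using assms(2)
proof induction
  case empty
  show ?case using assms by (intro exI[of _ "{}"]) auto
next
  case (insert r R)
  then obtain E' where E': "E \<inter> E' = {}" "orthonormal K (E \<union> E')"
    and iff: "\<And>v. (\<forall>e\<in>E \<union> E'. cip K e v = 0) \<longleftrightarrow> (\<forall>g\<in>E \<union> R. cip K g v = 0)"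
    by blast
  let ?D = "E \<union> E'"
  define w where "w = (\<lambda>k. r k - orth_proj K ?D r k)"
  have w_orth: "cip K e w = 0" if "e \<in> ?D" for e
    using cip_orth_proj[OF E'(2) that] by (simp add: w_def cip_diff_right)
  \<comment> \<open>On vectors orthogonal to \<open>?D\<close>, \<open>r\<close> and its residual
    \<open>w\<close> have the same inner products, so orthogonality to one can be traded for
    orthogonality to the other.\<close>
  have w_r: "cip K v w = cip K v r" if "\<forall>e\<in>?D. cip K e v = 0" for v
  proof -
    have "cip K v e = 0" if "e \<in> ?D" for e
      using \<open>\<forall>e\<in>?D. cip K e v = 0\<close> that by (subst cip_commute) simp
    thus ?thesis by (simp add: w_def cip_diff_right orth_proj_def cip_sum_right)
  qed
  have w_r': "cip K w v = cip K r v" if "\<forall>e\<in>?D. cip K e v = 0" for v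
    using w_r[OF that] by (subst (1 2) cip_commute) simp
  show ?case
  proof (cases "sqnorm K w = 0")
    case True
    \<comment> \<open>A vanishing residual means that \<open>r\<close> adds no new condition. For
      infinite \<open>K\<close> all sums default to 0, so that degenerate situation falls into this
      case too.\<close>
    have "cip K r v = 0" if "\<forall>e\<in>?D. cip K e v = 0" for v
    proof -
      have "w k = 0" if "k \<in> K" "finite K" for k
        using True that by (simp add: sqnorm_def sum_nonneg_eq_0_iff)
      hence "cip K w v = 0" by (cases "finite K") (auto simp: cip_def)
      thus ?thesis using w_r'[OF that] by simp
    qed
    thus ?thesis using E' iff by (intro exI[of _ E']) fastforce
  next
    case False
    define c where "c = sqrt (sqnorm K w)"
    have c: "c > 0" "c\<^sup>2 = sqnorm K w"
      using False sqnorm_nonneg[of K w] by (auto simp: c_def)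
    define u where "u = (\<lambda>k. complex_of_real (1 / c) * w k)"
    have "sqnorm K u = 1"
      using c unfolding u_def sqnorm_scale by (auto simp: power_divide norm_divide)
    hence uu: "cip K u u = 1" by (simp add: cip_self)
    have uv: "cip K u v = of_real (1 / c) * cip K w v" for v
      unfolding u_def cip_scale_left by simp
    have ue: "cip K u e = 0" "cip K e u = 0" if "e \<in> ?D" for e
    proof -
      have "cip K w e = 0" using w_orth[OF that] by (subst cip_commute) simp
      thus "cip K u e = 0" by (simp add: uv)
      thus "cip K e u = 0" by (subst cip_commute) simp
    qed
    have "u \<notin> ?D" using ue uu by fastforce
    have "orthonormal K (E \<union> insert u E')"
      using E'(2) uu ue \<open>u \<notin> ?D\<close> unfolding orthonormal_def by auto
    moreover have "E \<inter> insert u E' = {}" using E'(1) \<open>u \<notin> ?D\<close> by auto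
    moreover have "(\<forall>e\<in>E \<union> insert u E'. cip K e v = 0) \<longleftrightarrow> (\<forall>g\<in>E \<union> insert r R. cip K g v = 0)" for v
    proof -
      have "cip K u v = 0 \<longleftrightarrow> cip K r v = 0" if "\<forall>e\<in>?D. cip K e v = 0"
        using w_r'[OF that] c by (simp add: uv)
      thus ?thesis using iff[of v] by blast
    qed
    ultimately show ?thesis by (intro exI[of _ "insert u E'"]) blast
  qed
qed

text \<open>Classically: a state orthogonal to all measurements but the \<open>i\<close>-th one is undisturbed by
  those, so the measurements can be made mutually orthogonal without losing success probability.\<close>

lemma orthogonal_measurement:
  fixes r :: "'i \<Rightarrow> 'l \<Rightarrow> 'k \<Rightarrow> complex"
  assumes "finite I" "finite L"
    and bound: "\<forall>i\<in>I. \<forall>v. (\<Sum>l\<in>L. (cmod (cip K (r i l) v))\<^sup>2) \<le> c * sqnorm K v"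
  shows "\<exists>E. orthonormal K (\<Union>i\<in>I. E i) \<and> (\<forall>i\<in>I. \<forall>j\<in>I. i \<noteq> j \<longrightarrow> E i \<inter> E j = {}) \<and>
     (\<forall>v. (\<forall>i\<in>I. \<forall>l\<in>L. cip K (r i l) v = 0) \<longrightarrow> (\<forall>e\<in>(\<Union>i\<in>I. E i). cip K e v = 0)) \<and>
     (\<forall>i\<in>I. \<forall>v. (\<forall>j\<in>I. j \<noteq> i \<longrightarrow> (\<forall>l\<in>L. cip K (r j l) v = 0)) \<longrightarrow>
        (\<Sum>l\<in>L. (cmod (cip K (r i l) v))\<^sup>2) \<le> c * (\<Sum>e\<in>E i. (cmod (cip K e v))\<^sup>2))"
  using assms(1) bound
proof induction
  case empty
  show ?case by (simp add: orthonormal_def)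
next
  case (insert i I)
  have "\<forall>i\<in>I. \<forall>v. (\<Sum>l\<in>L. (cmod (cip K (r i l) v))\<^sup>2) \<le> c * sqnorm K v"
    using insert.prems by simp
  from insert.IH[OF this] obtain E where ortho: "orthonormal K (\<Union>i\<in>I. E i)"
    and disj: "\<forall>i\<in>I. \<forall>j\<in>I. i \<noteq> j \<longrightarrow> E i \<inter> E j = {}"
    and zero: "\<forall>v. (\<forall>i\<in>I. \<forall>l\<in>L. cip K (r i l) v = 0) \<longrightarrow> (\<forall>e\<in>(\<Union>i\<in>I. E i). cip K e v = 0)"
    and le: "\<forall>i\<in>I. \<forall>v. (\<forall>j\<in>I. j \<noteq> i \<longrightarrow> (\<forall>l\<in>L. cip K (r j l) v = 0)) \<longrightarrow>
        (\<Sum>l\<in>L. (cmod (cip K (r i l) v))\<^sup>2) \<le> c * (\<Sum>e\<in>E i. (cmod (cip K e v))\<^sup>2)"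
    by (elim exE conjE)
  let ?E = "\<Union>i\<in>I. E i"
  \<comment> \<open>\<open>E'\<close> collects the directions tested by measurement \<open>i\<close>
    that the earlier measurements do not cover.\<close>
  obtain E' where E': "?E \<inter> E' = {}" "orthonormal K (?E \<union> E')"
    and iff: "\<And>v. (\<forall>e\<in>?E \<union> E'. cip K e v = 0) \<longleftrightarrow> (\<forall>g\<in>?E \<union> r i ` L. cip K g v = 0)"
    using orthonormal_extend[OF ortho, of "r i ` L"] assms(2) by auto
  have on': "orthonormal K E'" using E'(2) by (auto simp: orthonormal_def)
  have new: "(\<Sum>l\<in>L. (cmod (cip K (r i l) v))\<^sup>2) \<le> c * (\<Sum>e\<in>E'. (cmod (cip K e v))\<^sup>2)"
    if v: "\<forall>j\<in>I. \<forall>l\<in>L. cip K (r j l) v = 0" for v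
  proof -
    let ?p = "orth_proj K E' v"
    have p0: "cip K e ?p = 0" if "e \<in> ?E" for e
    proof -
      have "cip K e e' = 0" if "e' \<in> E'" for e'
        using E' \<open>e \<in> ?E\<close> that unfolding orthonormal_def by (metis IntI UnCI emptyE)
      thus ?thesis by (simp add: orth_proj_def cip_sum_right)
    qed
    \<comment> \<open>Orthogonality to the earlier tests makes \<open>v\<close> orthogonal to
      \<open>?E\<close>, and subtracting \<open>?p\<close> removes its components along
      \<open>E'\<close>. By \<open>iff\<close>, measurement \<open>i\<close> does not see the rest;
      applying the bound to \<open>?p\<close> instead of \<open>v\<close> then leaves only the norm
      captured by \<open>E'\<close>.\<close>
    have "\<forall>e\<in>?E \<union> E'. cip K e (\<lambda>k. v k - ?p k) = 0"
      using p0 mp[OF spec[OF zero] v] cip_orth_proj[OF on'] unfolding cip_diff_right by fastforce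
    hence "cip K (r i l) (\<lambda>k. v k - ?p k) = 0" if "l \<in> L" for l
      using iff that by blast
    hence "cip K (r i l) v = cip K (r i l) ?p" if "l \<in> L" for l
      using that by (simp add: cip_diff_right)
    hence "(\<Sum>l\<in>L. (cmod (cip K (r i l) v))\<^sup>2) = (\<Sum>l\<in>L. (cmod (cip K (r i l) ?p))\<^sup>2)"
      by simp
    also have "\<dots> \<le> c * sqnorm K ?p" using insert.prems by blast
    finally show ?thesis using sqnorm_orth_proj[OF on'] by simp
  qed
  define D where "D = E(i := E')"
  have D: "D j = E j" if "j \<in> I" for j using that insert.hyps by (auto simp: D_def)
  have DU: "(\<Union>j\<in>insert i I. D j) = ?E \<union> E'" using D by (simp add: D_def[THEN fun_cong] Un_commute cong: SUP_cong)
  show ?case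
  proof (intro exI[of _ D] conjI ballI allI impI)
    show "orthonormal K (\<Union>j\<in>insert i I. D j)" using E' DU by simp
  next
    fix j k assume "j \<in> insert i I" "k \<in> insert i I" "j \<noteq> k"
    moreover have "E l \<inter> E' = {}" if "l \<in> I" for l using E'(1) that by blast
    ultimately show "D j \<inter> D k = {}"
      using D disj by (cases "j = i"; cases "k = i") (auto simp: D_def)
  next
    fix v e assume v: "\<forall>i\<in>insert i I. \<forall>l\<in>L. cip K (r i l) v = 0" and e: "e \<in> (\<Union>j\<in>insert i I. D j)"
    have "\<forall>g\<in>?E \<union> r i ` L. cip K g v = 0" using v spec[OF zero, of v] by auto
    thus "cip K e v = 0" using iff[of v] e unfolding DU by blast
  next
    fix j v assume j: "j \<in> insert i I"
      and v: "\<forall>k\<in>insert i I. k \<noteq> j \<longrightarrow> (\<forall>l\<in>L. cip K (r k l) v = 0)"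
    show "(\<Sum>l\<in>L. (cmod (cip K (r j l) v))\<^sup>2) \<le> c * (\<Sum>e\<in>D j. (cmod (cip K e v))\<^sup>2)"
    \<comment> \<open>For an older measurement the assumption on \<open>v\<close> has only become
      stronger, so \<open>le\<close> still applies.\<close>
    proof (cases "j = i")
      case True
      hence "\<forall>k\<in>I. \<forall>l\<in>L. cip K (r k l) v = 0"
        using v insert.hyps by (metis insertI2)
      from new[OF this] show ?thesis using True by (simp add: D_def)
    next
      case False
      hence "j \<in> I" "\<forall>k\<in>I. k \<noteq> j \<longrightarrow> (\<forall>l\<in>L. cip K (r k l) v = 0)" using j v by auto
      thus ?thesis using le by (simp add: D)
    qed
  qed
qed

section \<open>Families of bipartite amplitudes\<close>

text \<open>The matrix with rows in \<open>K\<close> and columns in \<open>S\<close> times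
  \<open>A\<close> has squared operator norm at most \<open>c\<close>. In the application
  \<open>s\<close> is the string of transferred bits, \<open>\<alpha>\<close> a party's initial
  assignment and \<open>k\<close> its final one.\<close>

definition bounded_family ::
  "'k set \<Rightarrow> 's set \<Rightarrow> 'a set \<Rightarrow> ('k \<Rightarrow> 's \<Rightarrow> 'a \<Rightarrow> complex) \<Rightarrow> real \<Rightarrow> bool" where
  "bounded_family K S A a c \<longleftrightarrow>
     (\<forall>g. (\<Sum>k\<in>K. (cmod (\<Sum>s\<in>S. \<Sum>\<alpha>\<in>A. a k s \<alpha> * g s \<alpha>))\<^sup>2) \<le> c * (\<Sum>s\<in>S. \<Sum>\<alpha>\<in>A. (cmod (g s \<alpha>))\<^sup>2))"

lemma bounded_familyD:
  "bounded_family K S A a c \<Longrightarrow>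
     (\<Sum>k\<in>K. (cmod (\<Sum>s\<in>S. \<Sum>\<alpha>\<in>A. a k s \<alpha> * g s \<alpha>))\<^sup>2) \<le> c * (\<Sum>s\<in>S. \<Sum>\<alpha>\<in>A. (cmod (g s \<alpha>))\<^sup>2)"
  by (simp add: bounded_family_def)

lemma bounded_family_subset:
  assumes "bounded_family K S A a c" "finite K" "K' \<subseteq> K"
  shows "bounded_family K' S A a c"
  unfolding bounded_family_def
proof
  fix g
  show "(\<Sum>k\<in>K'. (cmod (\<Sum>s\<in>S. \<Sum>\<alpha>\<in>A. a k s \<alpha> * g s \<alpha>))\<^sup>2) \<le> c * (\<Sum>s\<in>S. \<Sum>\<alpha>\<in>A. (cmod (g s \<alpha>))\<^sup>2)"
    by (rule order_trans[OF sum_mono2[OF assms(2,3)] bounded_familyD[OF assms(1)]]) simp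
qed

text \<open>Operator norms multiply under tensor products. Contracting with the second factor first
  gives \<open>h\<close>; the bound for \<open>a\<close> applies to \<open>h k'\<close> for each
  fixed \<open>k'\<close>, and then the bound for \<open>a'\<close> for each fixed \<open>s\<close>
  and \<open>\<alpha>\<close>.\<close>

lemma bounded_family_tensor:
  fixes a :: "'k \<Rightarrow> 's \<Rightarrow> 'a \<Rightarrow> complex" and a' :: "'k' \<Rightarrow> 's' \<Rightarrow> 'a' \<Rightarrow> complex"
  assumes a: "bounded_family K S A a c" and a': "bounded_family K' S' A' a' c'" and c: "0 \<le> c"
  shows "bounded_family (K \<times> K') (S \<times> S') (A \<times> A')
           (\<lambda>(k, k') (s, s') (\<alpha>, \<alpha>'). a k s \<alpha> * a' k' s' \<alpha>') (c * c')"
  unfolding bounded_family_def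
proof
  fix g :: "'s \<times> 's' \<Rightarrow> 'a \<times> 'a' \<Rightarrow> complex"
  define h where "h k' s \<alpha> = (\<Sum>s'\<in>S'. \<Sum>\<alpha>'\<in>A'. a' k' s' \<alpha>' * g (s, s') (\<alpha>, \<alpha>'))" for k' s \<alpha>
  have inner: "(\<Sum>s\<in>S \<times> S'. \<Sum>\<alpha>\<in>A \<times> A'.
      (case k of (k, k') \<Rightarrow> \<lambda>(s, s') (\<alpha>, \<alpha>'). a k s \<alpha> * a' k' s' \<alpha>') s \<alpha> * g s \<alpha>)
    = (\<Sum>s\<in>S. \<Sum>\<alpha>\<in>A. a (fst k) s \<alpha> * h (snd k) s \<alpha>)" for k
  proof -
    have "(\<Sum>s\<in>S \<times> S'. \<Sum>\<alpha>\<in>A \<times> A'.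
        (case k of (k, k') \<Rightarrow> \<lambda>(s, s') (\<alpha>, \<alpha>'). a k s \<alpha> * a' k' s' \<alpha>') s \<alpha> * g s \<alpha>)
      = (\<Sum>s\<in>S. \<Sum>s'\<in>S'. \<Sum>\<alpha>\<in>A. \<Sum>\<alpha>'\<in>A'. a (fst k) s \<alpha> * a' (snd k) s' \<alpha>' * g (s, s') (\<alpha>, \<alpha>'))"
      by (simp add: sum.cartesian_product' split_beta)
    also have "\<dots> = (\<Sum>s\<in>S. \<Sum>\<alpha>\<in>A. a (fst k) s \<alpha> * h (snd k) s \<alpha>)"
      unfolding h_def sum_distrib_left
      by (subst sum.swap[of _ S' A]) (simp add: mult.assoc)
    finally show ?thesis .
  qed
  have "(\<Sum>k\<in>K \<times> K'. (cmod (\<Sum>s\<in>S \<times> S'. \<Sum>\<alpha>\<in>A \<times> A'.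
      (case k of (k, k') \<Rightarrow> \<lambda>(s, s') (\<alpha>, \<alpha>'). a k s \<alpha> * a' k' s' \<alpha>') s \<alpha> * g s \<alpha>))\<^sup>2)
    = (\<Sum>k'\<in>K'. \<Sum>k\<in>K. (cmod (\<Sum>s\<in>S. \<Sum>\<alpha>\<in>A. a k s \<alpha> * h k' s \<alpha>))\<^sup>2)"
    unfolding inner by (simp add: sum.cartesian_product' sum.swap[of _ K' K])
  also have "\<dots> \<le> (\<Sum>k'\<in>K'. c * (\<Sum>s\<in>S. \<Sum>\<alpha>\<in>A. (cmod (h k' s \<alpha>))\<^sup>2))"
    by (intro sum_mono bounded_familyD[OF a])
  also have "\<dots> = c * (\<Sum>s\<in>S. \<Sum>\<alpha>\<in>A. \<Sum>k'\<in>K'. (cmod (h k' s \<alpha>))\<^sup>2)"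
    unfolding sum_distrib_left[symmetric]
    by (subst sum.swap[of _ S K']) (simp add: sum.swap[of _ A K'])
  also have "\<dots> \<le> c * (\<Sum>s\<in>S. \<Sum>\<alpha>\<in>A. c' * (\<Sum>s'\<in>S'. \<Sum>\<alpha>'\<in>A'. (cmod (g (s, s') (\<alpha>, \<alpha>')))\<^sup>2))"
    unfolding h_def by (intro mult_left_mono[OF _ c] sum_mono bounded_familyD[OF a'])
  also have "\<dots> = c * c' * (\<Sum>s\<in>S \<times> S'. \<Sum>\<alpha>\<in>A \<times> A'. (cmod (g s \<alpha>))\<^sup>2)"
    by (simp add: sum.cartesian_product' sum_distrib_left[symmetric] mult.assoc
        sum.swap[of _ S' A])
  finally show "(\<Sum>k\<in>K \<times> K'. (cmod (\<Sum>s\<in>S \<times> S'. \<Sum>\<alpha>\<in>A \<times> A'.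
      (case k of (k, k') \<Rightarrow> \<lambda>(s, s') (\<alpha>, \<alpha>'). a k s \<alpha> * a' k' s' \<alpha>') s \<alpha> * g s \<alpha>))\<^sup>2)
    \<le> c * c' * (\<Sum>s\<in>S \<times> S'. \<Sum>\<alpha>\<in>A \<times> A'. (cmod (g s \<alpha>))\<^sup>2)" .
qed

text \<open>\<open>M i j k l\<close> is the inner product of Alice's unnormalised message
  \<open>\<phi> i k\<close> with Bob's test vector \<open>r j l\<close>. The vanishing off-diagonal
  amplitudes make each message orthogonal to all tests for other inputs, so the tests can be
  replaced by disjoint parts of one orthonormal set. Bob's replacement costs \<open>c'\<close>,
  Alice's amplitudes cost \<open>c\<close>, and Bessel's inequality costs one copy of the norm of
  \<open>\<psi>\<close> for each bit string in \<open>S\<close>.\<close>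

lemma diagonal_bound:
  fixes a :: "'i \<Rightarrow> 'k \<Rightarrow> 's \<Rightarrow> 'a \<Rightarrow> complex" and b :: "'i \<Rightarrow> 'l \<Rightarrow> 's \<Rightarrow> 'b \<Rightarrow> complex"
    and \<psi> :: "'a \<Rightarrow> 'b \<Rightarrow> complex" and S :: "'s set" and A :: "'a set" and B :: "'b set"
    and p :: real
  defines "M \<equiv> \<lambda>i j k l. \<Sum>s\<in>S. \<Sum>\<alpha>\<in>A. \<Sum>\<beta>\<in>B. a i k s \<alpha> * b j l s \<beta> * \<psi> \<alpha> \<beta>"
  assumes fin: "finite I" "finite L" "finite S" "finite B"
    and a: "\<And>i. i \<in> I \<Longrightarrow> bounded_family K S A (a i) c"
    and b: "\<And>i. i \<in> I \<Longrightarrow> bounded_family L S B (b i) c'"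
    and c: "0 \<le> c" "0 \<le> c'"
    and zero: "\<And>i j k l. i \<in> I \<Longrightarrow> j \<in> I \<Longrightarrow> i \<noteq> j \<Longrightarrow> k \<in> K \<Longrightarrow> l \<in> L \<Longrightarrow> M i j k l = 0"
    and p: "\<And>i. i \<in> I \<Longrightarrow> p \<le> (\<Sum>k\<in>K. \<Sum>l\<in>L. (cmod (M i i k l))\<^sup>2)"
  shows "real (card I) * p \<le> c' * (c * (card S * (\<Sum>\<alpha>\<in>A. \<Sum>\<beta>\<in>B. (cmod (\<psi> \<alpha> \<beta>))\<^sup>2)))"
proof -
  define r where "r i l = (\<lambda>(s, \<beta>). cnj (b i l s \<beta>))" for i l
  define \<phi> where "\<phi> i k = (\<lambda>(s, \<beta>). \<Sum>\<alpha>\<in>A. a i k s \<alpha> * \<psi> \<alpha> \<beta>)" for i k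
  let ?J = "S \<times> B"
  have M: "cip ?J (r j l) (\<phi> i k) = M i j k l" for i j k l
    unfolding cip_def r_def \<phi>_def M_def
    by (simp add: sum.cartesian_product' sum_distrib_left sum.swap[of _ A B] mult_ac)
  have bound: "\<forall>i\<in>I. \<forall>v. (\<Sum>l\<in>L. (cmod (cip ?J (r i l) v))\<^sup>2) \<le> c' * sqnorm ?J v"
  proof (intro ballI allI)
    fix i v assume "i \<in> I"
    from bounded_familyD[OF b[OF this], of "curry v"]
    show "(\<Sum>l\<in>L. (cmod (cip ?J (r i l) v))\<^sup>2) \<le> c' * sqnorm ?J v"
      by (simp add: cip_def sqnorm_def r_def sum.cartesian_product')
  qed
  obtain E where E: "orthonormal ?J (\<Union>i\<in>I. E i)"
    and disj: "\<forall>i\<in>I. \<forall>j\<in>I. i \<noteq> j \<longrightarrow> E i \<inter> E j = {}"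
    and le: "\<forall>i\<in>I. \<forall>v. (\<forall>j\<in>I. j \<noteq> i \<longrightarrow> (\<forall>l\<in>L. cip ?J (r j l) v = 0)) \<longrightarrow>
        (\<Sum>l\<in>L. (cmod (cip ?J (r i l) v))\<^sup>2) \<le> c' * (\<Sum>e\<in>E i. (cmod (cip ?J e v))\<^sup>2)"
    using orthogonal_measurement[OF fin(1,2) bound] by (elim exE conjE)
  have finE: "finite (E i)" if "i \<in> I" for i
    using E that fin(1) unfolding orthonormal_def by (meson UN_upper finite_subset)
  \<comment> \<open>Alice's messages are combinations of these vectors, which do not depend on her
    input; their squared norms add up to \<open>card S\<close> times that of
    \<open>\<psi>\<close>.\<close>
  define w where "w s \<alpha> = (\<lambda>(s', \<beta>). if s' = s then \<psi> \<alpha> \<beta> else 0)" for s :: 's and \<alpha>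
  have we: "cip ?J e (w s \<alpha>) = (\<Sum>\<beta>\<in>B. cnj (e (s, \<beta>)) * \<psi> \<alpha> \<beta>)" if "s \<in> S" for s \<alpha> e
  proof -
    have "cip ?J e (w s \<alpha>) = (\<Sum>s'\<in>S. if s' = s then (\<Sum>\<beta>\<in>B. cnj (e (s, \<beta>)) * \<psi> \<alpha> \<beta>) else 0)"
      unfolding cip_def w_def sum.cartesian_product' by (intro sum.cong) auto
    thus ?thesis using fin(3) that by simp
  qed
  have wn: "sqnorm ?J (w s \<alpha>) = (\<Sum>\<beta>\<in>B. (cmod (\<psi> \<alpha> \<beta>))\<^sup>2)" if "s \<in> S" for s \<alpha>
  proof -
    have "sqnorm ?J (w s \<alpha>) = (\<Sum>s'\<in>S. if s' = s then (\<Sum>\<beta>\<in>B. (cmod (\<psi> \<alpha> \<beta>))\<^sup>2) else 0)"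
      unfolding sqnorm_def w_def sum.cartesian_product' by (intro sum.cong) auto
    thus ?thesis using fin(3) that by simp
  qed
  have e\<phi>: "cip ?J e (\<phi> i k) = (\<Sum>s\<in>S. \<Sum>\<alpha>\<in>A. a i k s \<alpha> * cip ?J e (w s \<alpha>))" for e i k
  proof -
    have "cip ?J e (\<phi> i k) = (\<Sum>s\<in>S. \<Sum>\<beta>\<in>B. \<Sum>\<alpha>\<in>A. a i k s \<alpha> * (cnj (e (s, \<beta>)) * \<psi> \<alpha> \<beta>))"
      unfolding cip_def \<phi>_def by (simp add: sum.cartesian_product' sum_distrib_left mult_ac)
    also have "\<dots> = (\<Sum>s\<in>S. \<Sum>\<alpha>\<in>A. a i k s \<alpha> * cip ?J e (w s \<alpha>))"
      by (intro sum.cong refl) (simp add: sum.swap[of _ A B] sum_distrib_left we)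
    finally show ?thesis .
  qed
  have "real (card I) * p \<le> (\<Sum>i\<in>I. \<Sum>k\<in>K. \<Sum>l\<in>L. (cmod (M i i k l))\<^sup>2)"
    using sum_mono[of I "\<lambda>_. p"] p by simp
  also have "\<dots> \<le> (\<Sum>i\<in>I. \<Sum>k\<in>K. c' * (\<Sum>e\<in>E i. (cmod (cip ?J e (\<phi> i k)))\<^sup>2))"
    using zero by (intro sum_mono) (auto simp flip: M intro!: le[rule_format])
  also have "\<dots> = c' * (\<Sum>i\<in>I. \<Sum>e\<in>E i. \<Sum>k\<in>K. (cmod (cip ?J e (\<phi> i k)))\<^sup>2)"
    by (simp add: sum_distrib_left sum.swap[where A=K])
  \<comment> \<open>For fixed \<open>e\<close>, the numbers \<open>cip ?J e (\<phi> i k)\<close>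
    arise by applying the matrix \<open>a i\<close> to the numbers
    \<open>cip ?J e (w s \<alpha>)\<close>. This removes Alice's input from the summand.\<close>
  also have "\<dots> \<le> c' * (\<Sum>i\<in>I. \<Sum>e\<in>E i. c * (\<Sum>s\<in>S. \<Sum>\<alpha>\<in>A. (cmod (cip ?J e (w s \<alpha>)))\<^sup>2))"
    unfolding e\<phi> by (intro mult_left_mono[OF _ c(2)] sum_mono bounded_familyD a)
  \<comment> \<open>Disjointness merges the sets \<open>E i\<close> into one orthonormal set, so the
    bound no longer grows with the number of inputs.\<close>
  also have "\<dots> = c' * (\<Sum>e\<in>(\<Union>i\<in>I. E i). c * (\<Sum>s\<in>S. \<Sum>\<alpha>\<in>A. (cmod (cip ?J e (w s \<alpha>)))\<^sup>2))"
    using finE disj fin(1) by (simp add: sum.UNION_disjoint)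
  also have "\<dots> = c' * (c * (\<Sum>s\<in>S. \<Sum>\<alpha>\<in>A. \<Sum>e\<in>(\<Union>i\<in>I. E i). (cmod (cip ?J e (w s \<alpha>)))\<^sup>2))"
    by (simp add: sum_distrib_left[symmetric] sum.swap[where A="\<Union>i\<in>I. E i"])
  also have "\<dots> \<le> c' * (c * (\<Sum>s\<in>S. \<Sum>\<alpha>\<in>A. sqnorm ?J (w s \<alpha>)))"
    by (intro mult_left_mono[OF _ c(2)] mult_left_mono[OF _ c(1)] sum_mono Bessel[OF E])
  also have "\<dots> = c' * (c * (card S * (\<Sum>\<alpha>\<in>A. \<Sum>\<beta>\<in>B. (cmod (\<psi> \<alpha> \<beta>))\<^sup>2)))"
    by (simp add: wn)
  finally show ?thesis .
qed

section \<open>The decomposition of a protocol along its transferred bits\<close>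

definition bits :: "nat \<Rightarrow> nat list set" where
  "bits t = {s. set s \<subseteq> {..<2} \<and> length s = t}"

lemma finite_bits [simp]: "finite (bits t)"
  unfolding bits_def by (rule finite_lists_length_eq) simp

lemma card_bits: "card (bits t) = 2 ^ t"
  by (simp add: bits_def card_lists_length_eq)

lemma bits_0: "bits 0 = {[]}"
  by (auto simp: bits_def)

lemma sum_bits_Suc: "(\<Sum>s\<in>bits (Suc t). f s) = (\<Sum>b<2. \<Sum>s\<in>bits t. f (b # s))"
proof -
  have "bits (Suc t) = (\<lambda>(b, s). b # s) ` ({..<2} \<times> bits t)"
    by (auto simp: bits_def length_Suc_conv image_iff)
  moreover have "inj_on (\<lambda>(b, s). b # s) ({..<2::nat} \<times> bits t)"
    by (auto simp: inj_on_def)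
  ultimately show ?thesis
    by (simp only: sum.reindex) (simp add: sum.cartesian_product comp_def split_beta)
qed

section \<open>Basis assignments on disjoint sets of registers\<close>

lemma finite_basis: "finite S \<Longrightarrow> finite (basis d S)"
  by (simp add: basis_def finite_PiE)

lemma finite_held [simp]: "finite (held P p t)"
  by (simp add: held_def)

lemma restrict_basis: "c \<in> basis d T \<Longrightarrow> S \<subseteq> T \<Longrightarrow> restrict c S \<in> basis d S"
  by (auto simp: basis_def)

lemma restrict_merge:
  assumes "A \<inter> B = {}" "\<alpha> \<in> basis d A" "\<beta> \<in> basis d B"
  shows "restrict (override_on \<beta> \<alpha> A) A = \<alpha>" "restrict (override_on \<beta> \<alpha> A) B = \<beta>"
proof -
  show "restrict (override_on \<beta> \<alpha> A) A = \<alpha>"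
    by (rule ext) (use assms(2) in \<open>simp add: basis_def PiE_iff extensional_def\<close>)
  have "x \<notin> A" if "x \<in> B" for x using assms(1) that by blast
  thus "restrict (override_on \<beta> \<alpha> A) B = \<beta>"
    by (intro ext) (use assms(3) in \<open>simp add: basis_def PiE_iff extensional_def restrict_def\<close>)
qed

lemma merge_basis:
  assumes "\<alpha> \<in> basis d A" "\<beta> \<in> basis d B"
  shows "override_on \<beta> \<alpha> A \<in> basis d (A \<union> B)"
  using assms by (auto simp: basis_def PiE_iff extensional_def override_on_def)

lemma merge_restrict:
  assumes "c \<in> basis d (A \<union> B)"
  shows "override_on (restrict c B) (restrict c A) A = c"
  using assms by (intro ext) (simp add: basis_def PiE_iff extensional_def override_on_def)

lemma sum_basis_split:
  assumes "A \<inter> B = {}"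
  shows "(\<Sum>c\<in>basis d (A \<union> B). h c) = (\<Sum>\<alpha>\<in>basis d A. \<Sum>\<beta>\<in>basis d B. h (override_on \<beta> \<alpha> A))"
  unfolding sum.cartesian_product
  by (rule sum.reindex_bij_witness[of _ "\<lambda>(\<alpha>, \<beta>). override_on \<beta> \<alpha> A"
        "\<lambda>c. (restrict c A, restrict c B)"])
    (auto simp: restrict_merge[OF assms] merge_basis merge_restrict restrict_basis)

lemma restrict_upd:
  assumes "c \<in> basis d S" "r \<notin> S"
  shows "restrict (c(r := b)) S = c"
  using assms by (intro ext) (auto simp: basis_def PiE_iff extensional_def restrict_def)

lemma upd_basis:
  assumes "c \<in> basis d (S - {r})" "r \<in> S" "b < d r"
  shows "c(r := b) \<in> basis d S"
  using assms by (auto simp: basis_def PiE_iff extensional_def)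

lemma restrict_id:
  "c \<in> basis d S \<Longrightarrow> restrict c S = c"
  by (simp add: basis_def)

lemma sum_basis_remove:
  assumes "r \<in> S"
  shows "(\<Sum>c\<in>basis d S. h c) = (\<Sum>b<d r. \<Sum>c\<in>basis d (S - {r}). h (c(r := b)))"
proof -
  have "c r < d r" if "c \<in> basis d S" for c using that assms by (auto simp: basis_def)
  thus ?thesis
    unfolding sum.cartesian_product
    by (intro sum.reindex_bij_witness[of _ "\<lambda>(b, c). c(r := b)" "\<lambda>c. (c r, restrict c (S - {r}))"])
      (auto simp: assms upd_basis restrict_id insert_absorb restrict_basis)
qed

section \<open>Norm estimates for a single round\<close>

lemma unitary_op_sqnorm:
  assumes "unitary_op d S U" "finite S"
  shows "sqnorm (basis d S) (\<lambda>k. \<Sum>a\<in>basis d S. U k a * v a) = sqnorm (basis d S) v"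
proof -
  let ?B = "basis d S"
  have "complex_of_real (sqnorm ?B (\<lambda>k. \<Sum>a\<in>?B. U k a * v a))
      = (\<Sum>k\<in>?B. \<Sum>a\<in>?B. \<Sum>b\<in>?B. cnj (v a) * v b * (cnj (U k a) * U k b))"
    unfolding cip_self[symmetric] cip_def
    by (simp only: cnj_sum complex_cnj_mult sum_product) (simp add: mult_ac)
  also have "\<dots> = (\<Sum>a\<in>?B. \<Sum>b\<in>?B. cnj (v a) * v b * (\<Sum>k\<in>?B. cnj (U k a) * U k b))"
    unfolding sum_distrib_left
    by (rule trans[OF sum.swap], rule sum.cong[OF refl], rule sum.swap)
  also have "\<dots> = (\<Sum>a\<in>?B. \<Sum>b\<in>?B. if a = b then cnj (v a) * v a else 0)"
    using assms(1) by (intro sum.cong) (auto simp: unitary_op_def)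
  also have "\<dots> = of_real (sqnorm ?B v)"
    using assms(2) unfolding cip_self[symmetric] cip_def by (simp add: finite_basis)
  finally show ?thesis unfolding of_real_eq_iff .
qed

text \<open>Cauchy--Schwarz for two terms; this is where each sent qubit costs a factor 2 in
  \<open>bounded_family_path_amp\<close>.\<close>

lemma cmod_sum_two: "(cmod (\<Sum>b<2::nat. z b))\<^sup>2 \<le> 2 * (\<Sum>b<2. (cmod (z b))\<^sup>2)"
proof -
  have "(cmod (z 0 + z 1))\<^sup>2 \<le> (cmod (z 0) + cmod (z 1))\<^sup>2"
    by (intro power_mono norm_triangle_ineq) simp
  also have "\<dots> \<le> 2 * ((cmod (z 0))\<^sup>2 + (cmod (z 1))\<^sup>2)"
    using sum_squares_bound[of "cmod (z 0)" "cmod (z 1)"] by (simp add: power2_sum)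
  finally show ?thesis by (simp add: numeral_2_eq_2)
qed

text \<open>The amplitude of \<open>p\<close> for ending with \<open>\<kappa>\<close> when starting with \<open>\<alpha>\<close>, given the values of all
  transferred qubits, the most recent one first.\<close>

fun path_amp :: "('x, 'y) protocol \<Rightarrow> party \<Rightarrow> (nat \<Rightarrow> operator) \<Rightarrow> nat \<Rightarrow>
    assignment \<Rightarrow> nat list \<Rightarrow> assignment \<Rightarrow> complex" where
  "path_amp P p U 0 \<kappa> s \<alpha> = (if \<kappa> = \<alpha> then 1 else 0)"
| "path_amp P p U (Suc t) \<kappa> s \<alpha> =
     (if sender P t = p
      then \<Sum>c\<in>basis (reg_dim P) (held P p t). U t (\<kappa>(qubit P t := hd s)) c * path_amp P p U t c (tl s) \<alpha>
      else if \<kappa> (qubit P t) = hd s then path_amp P p U t (restrict \<kappa> (held P p t)) (tl s) \<alpha> else 0)"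

lemma held_Suc_sender:
  "held P (sender P t) (Suc t) = held P (sender P t) t - {qubit P t}"
  by (cases "sender P t") (auto simp: held_def)

lemma held_Suc_receiver:
  assumes "qubit P t < reg_num P" "p \<noteq> sender P t"
  shows "held P p (Suc t) = insert (qubit P t) (held P p t)"
  using assms by (cases p; cases "sender P t") (auto simp: held_def)

definition sent :: "('x, 'y) protocol \<Rightarrow> party \<Rightarrow> nat \<Rightarrow> nat" where
  "sent P p t = card {u. u < t \<and> sender P u = p}"

lemma sent_Suc: "sent P p (Suc t) = (if sender P t = p then Suc (sent P p t) else sent P p t)"
proof -
  have "{u. u < Suc t \<and> sender P u = p} =
      (if sender P t = p then insert t {u. u < t \<and> sender P u = p} else {u. u < t \<and> sender P u = p})"
    by (auto simp: less_Suc_eq)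
  thus ?thesis by (simp add: sent_def)
qed

lemma sent_total: "sent P Alice t + sent P Bob t = t"
proof (induction t)
  case 0
  show ?case by (simp add: sent_def)
next
  case (Suc t)
  thus ?case by (cases "sender P t") (simp_all add: sent_Suc)
qed

text \<open>Sending costs a factor 2: the unitary preserves norms, but the two values of the
  departing qubit end up superposed in the same entries. Receiving is free: the value of the
  arriving qubit is recorded in the final assignment, so the contributions of the two values sit in
  different rows.\<close>

lemma bounded_family_path_amp:
  assumes "\<And>u. u < t \<Longrightarrow> qubit P u \<in> held P (sender P u) u \<and> reg_dim P (qubit P u) = 2"
    and "\<And>u. u < t \<Longrightarrow> sender P u = p \<Longrightarrow> unitary_op (reg_dim P) (held P p u) (U u)"
  shows "bounded_family (basis (reg_dim P) (held P p t)) (bits t) (basis (reg_dim P) (held P p 0))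
           (path_amp P p U t) (2 ^ sent P p t)"
  using assms
proof (induction t)
  case 0
  have "(\<Sum>\<alpha>\<in>basis (reg_dim P) (held P p 0). (if \<kappa> = \<alpha> then 1 else 0) * g \<alpha>) = (g \<kappa> :: complex)"
    if "\<kappa> \<in> basis (reg_dim P) (held P p 0)" for \<kappa> g
  proof -
    have "(\<Sum>\<alpha>\<in>basis (reg_dim P) (held P p 0). (if \<kappa> = \<alpha> then 1 else 0) * g \<alpha>)
        = (\<Sum>\<alpha>\<in>basis (reg_dim P) (held P p 0). if \<kappa> = \<alpha> then g \<kappa> else 0)"
      by (intro sum.cong) auto
    thus ?thesis using that by (simp add: finite_basis)
  qed
  thus ?case by (simp add: bounded_family_def bits_0 sent_def)
next
  case (Suc t)
  let ?d = "reg_dim P" and ?r = "qubit P t"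
  let ?A = "basis ?d (held P p 0)" and ?K = "basis ?d (held P p t)"
  have IH: "bounded_family ?K (bits t) ?A (path_amp P p U t) (2 ^ sent P p t)"
    using Suc by simp
  have r: "?r \<in> held P (sender P t) t" "?d ?r = 2" using Suc.prems(1)[of t] by auto
  show ?case
    unfolding bounded_family_def
  proof
    fix g :: "nat list \<Rightarrow> assignment \<Rightarrow> complex"
    \<comment> \<open>The matrix after \<open>t\<close> rounds, applied to the part of
      \<open>g\<close> whose most recent bit is \<open>b\<close>.\<close>
    define h where "h b c = (\<Sum>s\<in>bits t. \<Sum>\<alpha>\<in>?A. path_amp P p U t c s \<alpha> * g (b # s) \<alpha>)" for b c
    have h: "sqnorm ?K (h b) \<le> 2 ^ sent P p t * (\<Sum>s\<in>bits t. \<Sum>\<alpha>\<in>?A. (cmod (g (b # s) \<alpha>))\<^sup>2)" for b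
      unfolding sqnorm_def h_def by (rule bounded_familyD[OF IH])
    have hsum: "(\<Sum>b<2. sqnorm ?K (h b))
        \<le> 2 ^ sent P p t * (\<Sum>s\<in>bits (Suc t). \<Sum>\<alpha>\<in>?A. (cmod (g s \<alpha>))\<^sup>2)"
      unfolding sum_bits_Suc sum_distrib_left[of _ _ "{..<2}"] by (intro sum_mono h)
    show "(\<Sum>\<kappa>\<in>basis ?d (held P p (Suc t)).
          (cmod (\<Sum>s\<in>bits (Suc t). \<Sum>\<alpha>\<in>?A. path_amp P p U (Suc t) \<kappa> s \<alpha> * g s \<alpha>))\<^sup>2)
        \<le> 2 ^ sent P p (Suc t) * (\<Sum>s\<in>bits (Suc t). \<Sum>\<alpha>\<in>?A. (cmod (g s \<alpha>))\<^sup>2)"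
    proof (cases "sender P t = p")
      case True
      define w where "w b k = (\<Sum>c\<in>?K. U t k c * h b c)" for b k
      have w: "(\<Sum>s\<in>bits (Suc t). \<Sum>\<alpha>\<in>?A. path_amp P p U (Suc t) \<kappa> s \<alpha> * g s \<alpha>)
          = (\<Sum>b<2. w b (\<kappa>(?r := b)))" for \<kappa>
      proof -
        have "(\<Sum>s\<in>bits t. \<Sum>\<alpha>\<in>?A. path_amp P p U (Suc t) \<kappa> (b # s) \<alpha> * g (b # s) \<alpha>)
            = w b (\<kappa>(?r := b))" for b
        proof -
          have "(\<Sum>s\<in>bits t. \<Sum>\<alpha>\<in>?A. path_amp P p U (Suc t) \<kappa> (b # s) \<alpha> * g (b # s) \<alpha>)
            = (\<Sum>s\<in>bits t. \<Sum>\<alpha>\<in>?A. \<Sum>c\<in>?K. U t (\<kappa>(?r := b)) c * (path_amp P p U t c s \<alpha> * g (b # s) \<alpha>))"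
            using True by (simp add: sum_distrib_right mult.assoc)
          also have "\<dots> = (\<Sum>s\<in>bits t. \<Sum>c\<in>?K. \<Sum>\<alpha>\<in>?A. U t (\<kappa>(?r := b)) c * (path_amp P p U t c s \<alpha> * g (b # s) \<alpha>))"
            by (intro sum.cong refl sum.swap)
          also have "\<dots> = (\<Sum>c\<in>?K. \<Sum>s\<in>bits t. \<Sum>\<alpha>\<in>?A. U t (\<kappa>(?r := b)) c * (path_amp P p U t c s \<alpha> * g (b # s) \<alpha>))"
            by (rule sum.swap)
          finally show ?thesis unfolding w_def h_def sum_distrib_left .
        qed
        thus ?thesis unfolding sum_bits_Suc by simp
      qed
      have held: "held P p (Suc t) = held P p t - {?r}" and rin: "?r \<in> held P p t"
        using True held_Suc_sender[of P t] r by auto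
      have uni: "unitary_op ?d (held P p t) (U t)" using Suc.prems(2)[of t] True by simp
      \<comment> \<open>Fixing the sent qubit to \<open>b\<close> selects some of the entries of
        \<open>w b\<close>, which is the unitary image of \<open>h b\<close>.\<close>
      have single: "(\<Sum>\<kappa>\<in>basis ?d (held P p t - {?r}). (cmod (w b (\<kappa>(?r := b))))\<^sup>2) \<le> sqnorm ?K (h b)"
        if "b < 2" for b
      proof -
        have "(\<Sum>\<kappa>\<in>basis ?d (held P p t - {?r}). (cmod (w b (\<kappa>(?r := b))))\<^sup>2) \<le> sqnorm ?K (w b)"
          unfolding sqnorm_def sum_basis_remove[OF rin] r(2)
          by (rule member_le_sum) (use that in \<open>auto intro: sum_nonneg\<close>)
        also have "\<dots> = sqnorm ?K (h b)"
          unfolding w_def by (rule unitary_op_sqnorm[OF uni]) simp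
        finally show ?thesis .
      qed
      have "(\<Sum>\<kappa>\<in>basis ?d (held P p t - {?r}). (cmod (\<Sum>b<2. w b (\<kappa>(?r := b))))\<^sup>2)
          \<le> (\<Sum>\<kappa>\<in>basis ?d (held P p t - {?r}). 2 * (\<Sum>b<2. (cmod (w b (\<kappa>(?r := b))))\<^sup>2))"
        by (intro sum_mono cmod_sum_two)
      also have "\<dots> = 2 * (\<Sum>b<2. \<Sum>\<kappa>\<in>basis ?d (held P p t - {?r}). (cmod (w b (\<kappa>(?r := b))))\<^sup>2)"
        by (simp only: sum_distrib_left[symmetric] sum.swap[where A="{..<2}"])
      also have "\<dots> \<le> 2 * (\<Sum>b<2. sqnorm ?K (h b))"
        by (intro mult_left_mono sum_mono single) auto
      also have "\<dots> \<le> 2 ^ sent P p (Suc t) * (\<Sum>s\<in>bits (Suc t). \<Sum>\<alpha>\<in>?A. (cmod (g s \<alpha>))\<^sup>2)"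
        using hsum True by (simp add: sent_Suc mult.assoc)
      finally show ?thesis unfolding w held .
    next
      case False
      have held: "held P p (Suc t) = insert ?r (held P p t)" and rin: "?r \<notin> held P p t"
        using held_Suc_receiver[of P t p] r False by (auto simp: held_def)
      hence rem: "?r \<in> held P p (Suc t)" "held P p (Suc t) - {?r} = held P p t" by auto
      \<comment> \<open>Only bit strings whose head agrees with the received qubit
        contribute.\<close>
      have eq: "(\<Sum>s\<in>bits (Suc t). \<Sum>\<alpha>\<in>?A. path_amp P p U (Suc t) (\<kappa>(?r := b)) s \<alpha> * g s \<alpha>) = h b \<kappa>"
        if "\<kappa> \<in> ?K" "b < 2" for \<kappa> b
      proof -
        have "restrict (\<kappa>(?r := b)) (held P p t) = \<kappa>"
          using that(1) rin by (rule restrict_upd)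
        hence "(\<Sum>s\<in>bits (Suc t). \<Sum>\<alpha>\<in>?A. path_amp P p U (Suc t) (\<kappa>(?r := b)) s \<alpha> * g s \<alpha>)
            = (\<Sum>b'<2. if b' = b then h b \<kappa> else 0)"
          unfolding sum_bits_Suc h_def using False by (intro sum.cong) auto
        thus ?thesis using that(2) by simp
      qed
      have "(\<Sum>\<kappa>\<in>basis ?d (held P p (Suc t)).
          (cmod (\<Sum>s\<in>bits (Suc t). \<Sum>\<alpha>\<in>?A. path_amp P p U (Suc t) \<kappa> s \<alpha> * g s \<alpha>))\<^sup>2)
        = (\<Sum>b<2. sqnorm ?K (h b))"
        unfolding sum_basis_remove[OF rem(1)] rem(2) r(2) sqnorm_def
        by (intro sum.cong refl) (simp only: eq lessThan_iff)
      thus ?thesis using hsum False by (simp add: sent_Suc)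
    qed
  qed
qed

definition local_op :: "('x, 'y) protocol \<Rightarrow> 'x \<Rightarrow> 'y \<Rightarrow> party \<Rightarrow> nat \<Rightarrow> operator" where
  "local_op P x y p t = (case p of Alice \<Rightarrow> alice_op P t x | Bob \<Rightarrow> bob_op P t y)"

text \<open>Once the value of every transferred qubit is fixed, each party's evolution depends only
  on its own registers and input, so the amplitude of each path is a product. Stating this for an
  arbitrary \<open>p\<close> lets the induction step take \<open>p\<close> to be the sender and
  treat both parties at once.\<close>

lemma run_decomposition:
  assumes "\<And>u. u < t \<Longrightarrow> qubit P u \<in> held P (sender P u) u \<and> reg_dim P (qubit P u) = 2"
    and "c \<in> basis (reg_dim P) {..<reg_num P}"
  shows "run P x y t c = (\<Sum>s\<in>bits t. \<Sum>\<gamma>\<in>basis (reg_dim P) {..<reg_num P}.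
      path_amp P p (local_op P x y p) t (restrict c (held P p t)) s (restrict \<gamma> (held P p 0)) *
      path_amp P (other p) (local_op P x y (other p)) t (restrict c (held P (other p) t)) s
        (restrict \<gamma> (held P (other p) 0)) * init_state P \<gamma>)"
  using assms
proof (induction t arbitrary: c p)
  case 0
  let ?G = "basis (reg_dim P) {..<reg_num P}"
  have *: "restrict c (held P p 0) = restrict \<gamma> (held P p 0) \<and>
      restrict c (held P (other p) 0) = restrict \<gamma> (held P (other p) 0) \<longleftrightarrow> c = \<gamma>"
    if "\<gamma> \<in> ?G" for \<gamma>
  proof -
    have un: "{..<reg_num P} = held P p 0 \<union> held P (other p) 0"
      by (cases p) (auto simp: held_def intro: party.exhaust)
    thus ?thesis using merge_restrict[of c] merge_restrict[of \<gamma>] that 0(2) by metis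
  qed
  have single: "(\<Sum>s\<in>bits 0. g s) = g []" for g :: "nat list \<Rightarrow> complex"
    by (simp add: bits_0)
  have "(\<Sum>\<gamma>\<in>?G. path_amp P p (local_op P x y p) 0 (restrict c (held P p 0)) [] (restrict \<gamma> (held P p 0)) *
      path_amp P (other p) (local_op P x y (other p)) 0 (restrict c (held P (other p) 0)) []
        (restrict \<gamma> (held P (other p) 0)) * init_state P \<gamma>)
      = (\<Sum>\<gamma>\<in>?G. if c = \<gamma> then init_state P c else 0)"
    using * by (intro sum.cong) auto
  also have "\<dots> = run P x y 0 c" using 0 by (simp add: finite_basis)
  finally show ?case unfolding single by (rule sym)
next
  case (Suc t)
  let ?d = "reg_dim P" and ?G = "basis (reg_dim P) {..<reg_num P}" and ?r = "qubit P t"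
  let ?L = "local_op P x y"
  define W where "W p t c s \<gamma> = path_amp P p (?L p) t (restrict c (held P p t)) s (restrict \<gamma> (held P p 0))"
    for p t c s \<gamma>
  define o' where "o' = other (sender P t)"
  let ?p = "sender P t"
  let ?S = "held P ?p t" and ?T = "held P o' t"
  \<comment> \<open>The sender's amplitude after the unitary of round \<open>t\<close>, while the
    qubit to be transferred still counts among the sender's registers.\<close>
  define V where "V s \<gamma> = (\<Sum>a\<in>basis ?d ?S. ?L ?p t (restrict c ?S) a *
      path_amp P ?p (?L ?p) t a s (restrict \<gamma> (held P ?p 0)))" for s \<gamma>
  have r: "?r \<in> ?S" "?d ?r = 2" "?r < reg_num P" using Suc.prems(1)[of t] by (auto simp: held_def)
  have o': "o' \<noteq> ?p" unfolding o'_def by (cases ?p) auto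
  have disj: "?T \<inter> ?S = {}" using o' by (auto simp: held_def)
  have cr: "c ?r < 2" using Suc.prems(2) r(2,3) by (auto simp: basis_def dest!: PiE_mem)
  have IH: "run P x y t (override_on c a ?S)
      = (\<Sum>s\<in>bits t. \<Sum>\<gamma>\<in>?G. path_amp P ?p (?L ?p) t a s (restrict \<gamma> (held P ?p 0)) * W o' t c s \<gamma> * init_state P \<gamma>)"
    if a: "a \<in> basis ?d ?S" for a
  proof -
    have "?S \<union> {..<reg_num P} = {..<reg_num P}" by (auto simp: held_def)
    hence "override_on c a ?S \<in> ?G"
      using merge_basis[OF a Suc.prems(2)] by simp
    moreover have "restrict (override_on c a ?S) ?S = a"
      using a by (intro ext) (simp add: basis_def PiE_iff extensional_def)
    moreover have "restrict (override_on c a ?S) ?T = restrict c ?T"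
      using disj by (intro ext) (auto simp: restrict_def override_on_def)
    ultimately show ?thesis
      using Suc.IH[OF Suc.prems(1)[OF less_SucI], of "override_on c a ?S" ?p]
      unfolding o'_def[symmetric] W_def by (simp only:)
  qed
  have "round_op P x y t = ?L ?p t"
    by (simp add: round_op_def local_op_def)
  hence "run P x y (Suc t) c = (\<Sum>a\<in>basis ?d ?S. \<Sum>s\<in>bits t. \<Sum>\<gamma>\<in>?G. ?L ?p t (restrict c ?S) a *
      path_amp P ?p (?L ?p) t a s (restrict \<gamma> (held P ?p 0)) * (W o' t c s \<gamma> * init_state P \<gamma>))"
    by (simp add: apply_op_def IH sum_distrib_left mult.assoc)
  also have "\<dots> = (\<Sum>s\<in>bits t. \<Sum>\<gamma>\<in>?G. \<Sum>a\<in>basis ?d ?S. ?L ?p t (restrict c ?S) a *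
      path_amp P ?p (?L ?p) t a s (restrict \<gamma> (held P ?p 0)) * (W o' t c s \<gamma> * init_state P \<gamma>))"
    by (rule trans[OF sum.swap], rule sum.cong[OF refl], rule sum.swap)
  finally have run: "run P x y (Suc t) c = (\<Sum>s\<in>bits t. \<Sum>\<gamma>\<in>?G. V s \<gamma> * W o' t c s \<gamma> * init_state P \<gamma>)"
    by (simp only: V_def sum_distrib_right mult.assoc)
  \<comment> \<open>The head of the bit string restores the entry of \<open>c\<close> that the
    sender loses with the transferred register.\<close>
  have Wp: "W ?p (Suc t) c (c ?r # s) \<gamma> = V s \<gamma>" for s \<gamma>
  proof -
    have "(restrict c (?S - {?r}))(?r := c ?r) = restrict c ?S"
      using r(1) by (intro ext) (auto simp: restrict_def)
    thus ?thesis unfolding W_def V_def held_Suc_sender by simp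
  qed
  \<comment> \<open>The receiver enforces agreement with \<open>c ?r\<close>, so the sum over the
    new bit collapses to a single term.\<close>
  have Wo: "W o' (Suc t) c (b # s) \<gamma> = (if b = c ?r then W o' t c s \<gamma> else 0)" for b s \<gamma>
  proof -
    have "insert ?r ?T \<inter> ?T = ?T" by auto
    thus ?thesis unfolding W_def held_Suc_receiver[OF r(3) o'] using o' by simp
  qed
  have "(\<Sum>s\<in>bits (Suc t). \<Sum>\<gamma>\<in>?G. W ?p (Suc t) c s \<gamma> * W o' (Suc t) c s \<gamma> * init_state P \<gamma>)
      = (\<Sum>b<2. if b = c ?r then (\<Sum>s\<in>bits t. \<Sum>\<gamma>\<in>?G. V s \<gamma> * W o' t c s \<gamma> * init_state P \<gamma>) else 0)"
    unfolding sum_bits_Suc by (intro sum.cong refl) (simp add: Wo Wp)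
  hence main: "run P x y (Suc t) c
      = (\<Sum>s\<in>bits (Suc t). \<Sum>\<gamma>\<in>?G. W ?p (Suc t) c s \<gamma> * W o' (Suc t) c s \<gamma> * init_state P \<gamma>)"
    using cr unfolding run by simp
  have "p = ?p \<and> other p = o' \<or> p = o' \<and> other p = ?p"
    unfolding o'_def by (cases p; cases ?p) auto
  hence "run P x y (Suc t) c
      = (\<Sum>s\<in>bits (Suc t). \<Sum>\<gamma>\<in>?G. W p (Suc t) c s \<gamma> * W (other p) (Suc t) c s \<gamma> * init_state P \<gamma>)"
    using main by (elim disjE conjE) (simp_all only: mult.commute)
  thus ?case unfolding W_def .
qed

text \<open>This brings the acceptance probability into the form used by
  \<open>diagonal_bound\<close>: bounded matrices on either side and a unit vector
  \<open>\<psi>\<close> between them. The constants multiply to \<open>2 ^ q\<close>, since every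
  qubit is sent by exactly one party.\<close>

lemma protocol_factorization:
  fixes P :: "('x, 'y) protocol"
  assumes P: "qubit_protocol X Y q P"
  obtains K L A B :: "assignment set" and a :: "'x \<Rightarrow> assignment \<Rightarrow> nat list \<Rightarrow> assignment \<Rightarrow> complex"
    and b :: "'y \<Rightarrow> assignment \<Rightarrow> nat list \<Rightarrow> assignment \<Rightarrow> complex"
    and \<psi> :: "assignment \<Rightarrow> assignment \<Rightarrow> complex" and m m' :: nat
  where "finite K" "finite L" "finite A" "finite B" "m + m' = q"
    and "\<And>x. x \<in> X \<Longrightarrow> bounded_family K (bits q) A (a x) (2 ^ m)"
    and "\<And>y. y \<in> Y \<Longrightarrow> bounded_family L (bits q) B (b y) (2 ^ m')"
    and "(\<Sum>\<alpha>\<in>A. \<Sum>\<beta>\<in>B. (cmod (\<psi> \<alpha> \<beta>))\<^sup>2) = 1"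
    and "\<And>x y. prob_output_1 q P x y = (\<Sum>k\<in>K. \<Sum>l\<in>L.
          (cmod (\<Sum>s\<in>bits q. \<Sum>\<alpha>\<in>A. \<Sum>\<beta>\<in>B. a x k s \<alpha> * b y l s \<beta> * \<psi> \<alpha> \<beta>))\<^sup>2)"
proof -
  let ?d = "reg_dim P" and ?N = "{..<reg_num P}" and ?r = "qubit P (q - 1)"
  let ?H = "\<lambda>p t. basis (reg_dim P) (held P p t)"
  \<comment> \<open>Only the party holding the output qubit is restricted. The condition is void for
    the other one, so the accepting assignments form a product set.\<close>
  define good where "good p = {k \<in> ?H p q. ?r \<in> held P p q \<longrightarrow> k ?r = 1}" for p
  define a where "a x = path_amp P Alice (\<lambda>u. alice_op P u x) q" for x
  define b where "b y = path_amp P Bob (\<lambda>u. bob_op P u y) q" for y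
  define \<psi> where "\<psi> \<alpha> \<beta> = init_state P (override_on \<beta> \<alpha> (held P Alice 0))" for \<alpha> \<beta>
  have q: "q \<ge> 1" and norm: "(\<Sum>c\<in>basis ?d ?N. (cmod (init_state P c))\<^sup>2) = 1"
    and qub: "\<And>u. u < q \<Longrightarrow> qubit P u \<in> held P (sender P u) u \<and> ?d (qubit P u) = 2"
    and uniA: "\<And>u x. u < q \<Longrightarrow> sender P u = Alice \<Longrightarrow> x \<in> X \<Longrightarrow> unitary_op ?d (held P Alice u) (alice_op P u x)"
    and uniB: "\<And>u y. u < q \<Longrightarrow> sender P u = Bob \<Longrightarrow> y \<in> Y \<Longrightarrow> unitary_op ?d (held P Bob u) (bob_op P u y)"
    using P unfolding qubit_protocol_def by blast+
  have un: "?N = held P Alice t \<union> held P Bob t" and disj: "held P Alice t \<inter> held P Bob t = {}" for t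
    by (auto simp: held_def intro: party.exhaust)
  have rN: "?r < reg_num P" using qub[of "q - 1"] q by (auto simp: held_def)
  have split: "(\<Sum>c\<in>basis ?d ?N. h c) = (\<Sum>k\<in>?H Alice t. \<Sum>l\<in>?H Bob t. h (override_on l k (held P Alice t)))"
    for h :: "assignment \<Rightarrow> 'z::comm_monoid_add" and t
    unfolding un[of t] by (rule sum_basis_split[OF disj])
  show ?thesis
  proof
    show "finite (good Alice)" "finite (good Bob)" "finite (?H Alice 0)" "finite (?H Bob 0)"
      by (simp_all add: good_def finite_basis)
    show "sent P Alice q + sent P Bob q = q" by (rule sent_total)
    show "bounded_family (good Alice) (bits q) (?H Alice 0) (a x) (2 ^ sent P Alice q)" if "x \<in> X" for x
      unfolding a_def
      by (rule bounded_family_subset[OF bounded_family_path_amp])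
        (use qub uniA that in \<open>auto simp: good_def finite_basis\<close>)
    show "bounded_family (good Bob) (bits q) (?H Bob 0) (b y) (2 ^ sent P Bob q)" if "y \<in> Y" for y
      unfolding b_def
      by (rule bounded_family_subset[OF bounded_family_path_amp])
        (use qub uniB that in \<open>auto simp: good_def finite_basis\<close>)
    show "(\<Sum>\<alpha>\<in>?H Alice 0. \<Sum>\<beta>\<in>?H Bob 0. (cmod (\<psi> \<alpha> \<beta>))\<^sup>2) = 1"
      using norm unfolding split[of _ 0] \<psi>_def .
    fix x y
    define amp where "amp k l = (\<Sum>s\<in>bits q. \<Sum>\<alpha>\<in>?H Alice 0. \<Sum>\<beta>\<in>?H Bob 0. a x k s \<alpha> * b y l s \<beta> * \<psi> \<alpha> \<beta>)"
      for k l
    have run: "run P x y q (override_on l k (held P Alice q)) = amp k l"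
      if k: "k \<in> ?H Alice q" and l: "l \<in> ?H Bob q" for k l
    proof -
      have "override_on l k (held P Alice q) \<in> basis ?d ?N"
        unfolding un[of q] by (rule merge_basis[OF k l])
      from run_decomposition[OF qub this, where x=x and y=y and p=Alice]
      have "run P x y q (override_on l k (held P Alice q)) = (\<Sum>s\<in>bits q. \<Sum>\<gamma>\<in>basis ?d ?N.
          a x k s (restrict \<gamma> (held P Alice 0)) * b y l s (restrict \<gamma> (held P Bob 0)) * init_state P \<gamma>)"
        by (simp add: restrict_merge[OF disj k l] a_def b_def local_op_def[abs_def])
      also have "\<dots> = amp k l"
        unfolding split[of _ 0] amp_def \<psi>_def
        by (intro sum.cong refl) (simp add: restrict_merge[OF disj])
      finally show ?thesis .
    qed
    have good: "override_on l k (held P Alice q) ?r = 1 \<longleftrightarrow> k \<in> good Alice \<and> l \<in> good Bob"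
      if k: "k \<in> ?H Alice q" and l: "l \<in> ?H Bob q" for k l
      using that rN un[of q] disj[of q] by (auto simp: good_def override_on_def)
    have "prob_output_1 q P x y =
        (\<Sum>c\<in>basis ?d ?N. if c ?r = 1 then (cmod (run P x y q c))\<^sup>2 else 0)"
      unfolding prob_output_1_def by (rule sum.inter_filter) (simp add: finite_basis)
    also have "\<dots> = (\<Sum>k\<in>?H Alice q. \<Sum>l\<in>?H Bob q.
        if k \<in> good Alice then if l \<in> good Bob then (cmod (amp k l))\<^sup>2 else 0 else 0)"
      unfolding split[of _ q] by (intro sum.cong refl) (simp add: run good del: One_nat_def)
    also have "\<dots> = (\<Sum>k\<in>?H Alice q. if k \<in> good Alice then
        (\<Sum>l\<in>?H Bob q. if l \<in> good Bob then (cmod (amp k l))\<^sup>2 else 0) else 0)"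
      by (intro sum.cong) auto
    also have "\<dots> = (\<Sum>k\<in>?H Alice q \<inter> good Alice. \<Sum>l\<in>?H Bob q \<inter> good Bob. (cmod (amp k l))\<^sup>2)"
      by (simp add: sum.inter_restrict finite_basis)
    also have "\<dots> = (\<Sum>k\<in>good Alice. \<Sum>l\<in>good Bob. (cmod (amp k l))\<^sup>2)"
      by (intro sum.cong) (auto simp: good_def)
    finally show "prob_output_1 q P x y = (\<Sum>k\<in>good Alice. \<Sum>l\<in>good Bob.
          (cmod (\<Sum>s\<in>bits q. \<Sum>\<alpha>\<in>?H Alice 0. \<Sum>\<beta>\<in>?H Bob 0. a x k s \<alpha> * b y l s \<beta> * \<psi> \<alpha> \<beta>))\<^sup>2)"
      unfolding amp_def .
  qed
qed

section \<open>The fooling set bound\<close>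

text \<open>Two copies with exchanged roles: the first side combines Alice of copy one with Bob of
  copy two, the second side combines the remaining two. Regrouping factors and summations turns the
  joint amplitude into the product of the amplitudes of the copies.\<close>

lemma tensor_amplitude:
  fixes a a' :: "'s \<Rightarrow> 'a \<Rightarrow> complex" and b b' :: "'s \<Rightarrow> 'b \<Rightarrow> complex"
  shows "(\<Sum>(s, s')\<in>S \<times> S. \<Sum>(\<alpha>, \<beta>')\<in>A \<times> B. \<Sum>(\<beta>, \<alpha>')\<in>B \<times> A.
      (a s \<alpha> * b' s' \<beta>') * (b s \<beta> * a' s' \<alpha>') * (\<psi> \<alpha> \<beta> * \<psi> \<alpha>' \<beta>'))
    = (\<Sum>s\<in>S. \<Sum>\<alpha>\<in>A. \<Sum>\<beta>\<in>B. a s \<alpha> * b s \<beta> * \<psi> \<alpha> \<beta>) *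
      (\<Sum>s\<in>S. \<Sum>\<alpha>\<in>A. \<Sum>\<beta>\<in>B. a' s \<alpha> * b' s \<beta> * \<psi> \<alpha> \<beta>)"
proof -
  have swap: "(\<Sum>\<beta>'\<in>B. \<Sum>\<beta>\<in>B. \<Sum>\<alpha>'\<in>A. g \<beta>' \<beta> \<alpha>') = (\<Sum>\<alpha>'\<in>A. \<Sum>\<beta>\<in>B. \<Sum>\<beta>'\<in>B. g \<beta>' \<beta> \<alpha>')"
    for g :: "'b \<Rightarrow> 'b \<Rightarrow> 'a \<Rightarrow> complex"
  proof -
    have "(\<Sum>\<beta>'\<in>B. \<Sum>\<beta>\<in>B. \<Sum>\<alpha>'\<in>A. g \<beta>' \<beta> \<alpha>') = (\<Sum>\<beta>\<in>B. \<Sum>\<alpha>'\<in>A. \<Sum>\<beta>'\<in>B. g \<beta>' \<beta> \<alpha>')"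
      by (rule trans[OF sum.swap], rule sum.cong[OF refl], rule sum.swap)
    thus ?thesis by (simp only: sum.swap[of _ A B])
  qed
  have "(\<Sum>s\<in>S. \<Sum>\<alpha>\<in>A. \<Sum>\<beta>\<in>B. a s \<alpha> * b s \<beta> * \<psi> \<alpha> \<beta>) *
      (\<Sum>s\<in>S. \<Sum>\<alpha>\<in>A. \<Sum>\<beta>\<in>B. a' s \<alpha> * b' s \<beta> * \<psi> \<alpha> \<beta>)
    = (\<Sum>s\<in>S. \<Sum>s'\<in>S. \<Sum>\<alpha>\<in>A. \<Sum>\<alpha>'\<in>A. \<Sum>\<beta>\<in>B. \<Sum>\<beta>'\<in>B.
      a s \<alpha> * b s \<beta> * \<psi> \<alpha> \<beta> * (a' s' \<alpha>' * b' s' \<beta>' * \<psi> \<alpha>' \<beta>'))"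
    by (simp only: sum_product)
  also have "\<dots> = (\<Sum>s\<in>S. \<Sum>s'\<in>S. \<Sum>\<alpha>\<in>A. \<Sum>\<beta>'\<in>B. \<Sum>\<beta>\<in>B. \<Sum>\<alpha>'\<in>A.
      a s \<alpha> * b s \<beta> * \<psi> \<alpha> \<beta> * (a' s' \<alpha>' * b' s' \<beta>' * \<psi> \<alpha>' \<beta>'))"
    by (simp only: swap)
  also have "\<dots> = (\<Sum>s\<in>S. \<Sum>s'\<in>S. \<Sum>\<alpha>\<in>A. \<Sum>\<beta>'\<in>B. \<Sum>\<beta>\<in>B. \<Sum>\<alpha>'\<in>A.
      (a s \<alpha> * b' s' \<beta>') * (b s \<beta> * a' s' \<alpha>') * (\<psi> \<alpha> \<beta> * \<psi> \<alpha>' \<beta>'))"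
    by (intro sum.cong refl) (simp only: mult_ac)
  finally show ?thesis
    by (simp only: sum.cartesian_product' prod.case)
qed

text \<open>Each \<open>z\<close> in \<open>F\<close> serves as the input of both sides of the
  doubled protocol. For distinct \<open>z\<close> and \<open>w\<close> one of the two crossed pairs
  is a zero of \<open>f\<close>, so one copy never accepts and the product amplitude vanishes, which
  is what \<open>diagonal_bound\<close> requires.\<close>

lemma card_fooling_set:
  fixes P :: "('x, 'y) protocol"
  assumes F: "one_fooling_set X Y f F" "finite F"
    and P: "qubit_protocol X Y q P" "one_sided_computes X Y f q P"
  shows "real (card F) \<le> 2 ^ (4 * q + 2)"
proof -
  obtain K L A B :: "assignment set" and a :: "'x \<Rightarrow> assignment \<Rightarrow> nat list \<Rightarrow> assignment \<Rightarrow> complex"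
    and b :: "'y \<Rightarrow> assignment \<Rightarrow> nat list \<Rightarrow> assignment \<Rightarrow> complex"
    and \<psi> :: "assignment \<Rightarrow> assignment \<Rightarrow> complex" and m m' :: nat
    where fin: "finite K" "finite L" "finite A" "finite B" and m: "m + m' = q"
    and a: "\<And>x. x \<in> X \<Longrightarrow> bounded_family K (bits q) A (a x) (2 ^ m)"
    and b: "\<And>y. y \<in> Y \<Longrightarrow> bounded_family L (bits q) B (b y) (2 ^ m')"
    and norm: "(\<Sum>\<alpha>\<in>A. \<Sum>\<beta>\<in>B. (cmod (\<psi> \<alpha> \<beta>))\<^sup>2) = 1"
    and prob: "\<And>x y. prob_output_1 q P x y = (\<Sum>k\<in>K. \<Sum>l\<in>L.
          (cmod (\<Sum>s\<in>bits q. \<Sum>\<alpha>\<in>A. \<Sum>\<beta>\<in>B. a x k s \<alpha> * b y l s \<beta> * \<psi> \<alpha> \<beta>))\<^sup>2)"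
    by (rule protocol_factorization[OF P(1)]) (rule that)
  let ?S = "bits q"
  define M where "M x y k l = (\<Sum>s\<in>?S. \<Sum>\<alpha>\<in>A. \<Sum>\<beta>\<in>B. a x k s \<alpha> * b y l s \<beta> * \<psi> \<alpha> \<beta>)" for x y k l
  note prob = prob[folded M_def]
  define a2 where "a2 z = (\<lambda>(k, l) (s, s') (\<alpha>, \<beta>). a (fst z) k s \<alpha> * b (snd z) l s' \<beta>)" for z
  define b2 where "b2 z = (\<lambda>(l, k) (s, s') (\<beta>, \<alpha>). b (snd z) l s \<beta> * a (fst z) k s' \<alpha>)" for z
  define \<psi>2 where "\<psi>2 = (\<lambda>(\<alpha>, \<beta>') (\<beta>, \<alpha>'). \<psi> \<alpha> \<beta> * \<psi> \<alpha>' \<beta>')"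
  have M2: "(\<Sum>s\<in>?S \<times> ?S. \<Sum>\<alpha>\<in>A \<times> B. \<Sum>\<beta>\<in>B \<times> A. a2 z k s \<alpha> * b2 w l s \<beta> * \<psi>2 \<alpha> \<beta>)
      = M (fst z) (snd w) (fst k) (fst l) * M (fst w) (snd z) (snd l) (snd k)" for z w k l
    using tensor_amplitude[of "a (fst z) (fst k)" "b (snd z) (snd k)" "b (snd w) (fst l)"
        "a (fst w) (snd l)" \<psi> B A ?S]
    unfolding a2_def b2_def \<psi>2_def M_def by (simp add: split_beta)
  \<comment> \<open>The absence of error on zeros of \<open>f\<close> is essential: a sum of squares
    equal to 0 forces every accepting amplitude to vanish.\<close>
  have zero: "M x y k l = 0" if "x \<in> X" "y \<in> Y" "\<not> f (x, y)" "k \<in> K" "l \<in> L" for x y k l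
  proof -
    have "(\<Sum>k\<in>K. \<Sum>l\<in>L. (cmod (M x y k l))\<^sup>2) = 0"
      using P(2) that by (simp add: one_sided_computes_def flip: prob)
    thus ?thesis using fin that by (simp add: sum_nonneg_eq_0_iff sum_nonneg)
  qed
  have FXY: "fst z \<in> X" "snd z \<in> Y" "f z" if "z \<in> F" for z
    using F(1) that by (auto simp: one_fooling_set_def)
  have norm2: "(\<Sum>\<alpha>\<in>A \<times> B. \<Sum>\<beta>\<in>B \<times> A. (cmod (\<psi>2 \<alpha> \<beta>))\<^sup>2) = 1"
  proof -
    have "(\<Sum>\<alpha>\<in>A \<times> B. \<Sum>\<beta>\<in>B \<times> A. (cmod (\<psi>2 \<alpha> \<beta>))\<^sup>2)
        = (\<Sum>\<alpha>\<in>A. \<Sum>\<beta>'\<in>B. \<Sum>\<beta>\<in>B. \<Sum>\<alpha>'\<in>A. (cmod (\<psi> \<alpha> \<beta>))\<^sup>2 * (cmod (\<psi> \<alpha>' \<beta>'))\<^sup>2)"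
      by (simp add: \<psi>2_def sum.cartesian_product' norm_mult power_mult_distrib)
    also have "\<dots> = (\<Sum>\<alpha>\<in>A. \<Sum>\<beta>\<in>B. \<Sum>\<beta>'\<in>B. \<Sum>\<alpha>'\<in>A. (cmod (\<psi> \<alpha> \<beta>))\<^sup>2 * (cmod (\<psi> \<alpha>' \<beta>'))\<^sup>2)"
      by (rule sum.cong[OF refl], rule sum.swap)
    also have "\<dots> = (\<Sum>\<alpha>\<in>A. \<Sum>\<beta>\<in>B. (cmod (\<psi> \<alpha> \<beta>))\<^sup>2) * (\<Sum>\<beta>'\<in>B. \<Sum>\<alpha>'\<in>A. (cmod (\<psi> \<alpha>' \<beta>'))\<^sup>2)"
      by (simp only: sum_distrib_left[symmetric] sum_distrib_right[symmetric])
    also have "\<dots> = 1"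
      using norm sum.swap[of "\<lambda>\<alpha> \<beta>. (cmod (\<psi> \<alpha> \<beta>))\<^sup>2" B A] by simp
    finally show ?thesis .
  qed
  have "real (card F) * (1 / 4) \<le> (2 ^ m' * 2 ^ m) * ((2 ^ m * 2 ^ m') *
      (real (card (?S \<times> ?S)) * (\<Sum>\<alpha>\<in>A \<times> B. \<Sum>\<beta>\<in>B \<times> A. (cmod (\<psi>2 \<alpha> \<beta>))\<^sup>2)))"
  proof (rule diagonal_bound[where K = "K \<times> L" and L = "L \<times> K" and a = a2 and b = b2])
    show "bounded_family (K \<times> L) (?S \<times> ?S) (A \<times> B) (a2 z) (2 ^ m * 2 ^ m')" if "z \<in> F" for z
      unfolding a2_def by (intro bounded_family_tensor a b FXY that) simp
    show "bounded_family (L \<times> K) (?S \<times> ?S) (B \<times> A) (b2 z) (2 ^ m' * 2 ^ m)" if "z \<in> F" for z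
      unfolding b2_def by (intro bounded_family_tensor a b FXY that) simp
    show "(\<Sum>s\<in>?S \<times> ?S. \<Sum>\<alpha>\<in>A \<times> B. \<Sum>\<beta>\<in>B \<times> A. a2 z k s \<alpha> * b2 w l s \<beta> * \<psi>2 \<alpha> \<beta>) = 0"
      if "z \<in> F" "w \<in> F" "z \<noteq> w" "k \<in> K \<times> L" "l \<in> L \<times> K" for z w k l
    proof -
      have "\<not> f (fst z, snd w) \<or> \<not> f (fst w, snd z)"
        using F(1) that(1-3) unfolding one_fooling_set_def by (metis prod.collapse)
      moreover have "fst k \<in> K" "snd k \<in> L" "fst l \<in> L" "snd l \<in> K"
        using that(4,5) by (auto simp: mem_Times_iff)
      ultimately have "M (fst z) (snd w) (fst k) (fst l) = 0 \<or> M (fst w) (snd z) (snd l) (snd k) = 0"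
        using zero FXY(1,2) that(1,2) by blast
      thus ?thesis unfolding M2 by simp
    qed
    show "1 / 4 \<le> (\<Sum>k\<in>K \<times> L. \<Sum>l\<in>L \<times> K. (cmod
        (\<Sum>s\<in>?S \<times> ?S. \<Sum>\<alpha>\<in>A \<times> B. \<Sum>\<beta>\<in>B \<times> A. a2 z k s \<alpha> * b2 z l s \<beta> * \<psi>2 \<alpha> \<beta>))\<^sup>2)"
      if "z \<in> F" for z
    proof -
      let ?p = "prob_output_1 q P (fst z) (snd z)"
      let ?g = "\<lambda>k l. (cmod (M (fst z) (snd z) k l))\<^sup>2"
      have "1 / 2 \<le> ?p" using P(2) FXY[OF that] by (simp add: one_sided_computes_def)
      hence "(1 / 2) * (1 / 2) \<le> ?p * ?p" by (intro mult_mono) auto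
      \<comment> \<open>The second copy has exchanged roles, so its two outcome sums are taken in
        the opposite order.\<close>
      also have "?p * ?p = (\<Sum>k\<in>K. \<Sum>l\<in>L. ?g k l) * (\<Sum>l\<in>L. \<Sum>k\<in>K. ?g k l)"
        unfolding prob by (subst (2) sum.swap) (rule refl)
      also have "\<dots> = (\<Sum>k\<in>K. \<Sum>l'\<in>L. \<Sum>l\<in>L. \<Sum>k'\<in>K. ?g k l * ?g k' l')"
        by (simp only: sum_product)
      also have "\<dots> = (\<Sum>k\<in>K \<times> L. \<Sum>l\<in>L \<times> K. (cmod
        (\<Sum>s\<in>?S \<times> ?S. \<Sum>\<alpha>\<in>A \<times> B. \<Sum>\<beta>\<in>B \<times> A. a2 z k s \<alpha> * b2 z l s \<beta> * \<psi>2 \<alpha> \<beta>))\<^sup>2)"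
        unfolding M2 by (simp add: sum.cartesian_product' norm_mult power_mult_distrib)
      finally show ?thesis by simp
    qed
  qed (use F fin in auto)
  \<comment> \<open>Each side contributes \<open>2 ^ q\<close>, and the pairs of bit strings
    contribute \<open>2 ^ (2 * q)\<close>. The acceptance bound 1/4 later adds 2 to the
    exponent.\<close>
  also have "\<dots> = 2 ^ (4 * q)"
    unfolding norm2 m[symmetric]
    by (simp add: card_cartesian_product card_bits m power_add[symmetric] mult.commute)
      (simp flip: power_add add: m[symmetric] algebra_simps)
  finally show ?thesis by (simp add: power_add)
qed

theorem corollary2:
  fixes X :: "'x set" and Y :: "'y set" and f :: "'x \<times> 'y \<Rightarrow> bool"
  assumes "finite X" and "finite Y"
  shows "ereal_of_enat (Q1_star X Y f) \<ge> ereal (1 / 4) * log2_ereal (fool1 X Y f) - ereal (1 / 2)"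
proof (cases "fool1 X Y f = 0")
  case True
  thus ?thesis by (simp add: log2_ereal_def)
next
  case False
  let ?Q = "{q. \<exists>P. qubit_protocol X Y q P \<and> one_sided_computes X Y f q P}"
  show ?thesis
  proof (cases "?Q = {}")
    case True
    thus ?thesis by (simp add: Q1_star_def Inf_enat_def)
  next
    case nonempty: False
    \<comment> \<open>The infimum of a nonempty set of \<open>enat\<close> is its least element,
      hence it is attained by an actual protocol.\<close>
    then obtain n where "enat n \<in> enat ` ?Q" by blast
    from LeastI[of "\<lambda>x. x \<in> enat ` ?Q", OF this] nonempty
    have "Q1_star X Y f \<in> enat ` ?Q"
      by (auto simp: Q1_star_def Inf_enat_def)
    then obtain q P where q: "Q1_star X Y f = enat q"
      and P: "qubit_protocol X Y q P" "one_sided_computes X Y f q P" by blast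
    let ?FF = "{F. one_fooling_set X Y f F}"
    have "?FF \<subseteq> Pow (X \<times> Y)" by (auto simp: one_fooling_set_def)
    hence "finite ?FF" using assms by (simp add: finite_subset)
    \<comment> \<open>The empty fooling set guarantees that the maximum is taken over a nonempty set
      and is attained.\<close>
    moreover have "{} \<in> ?FF" by (simp add: one_fooling_set_def)
    ultimately have "fool1 X Y f \<in> card ` ?FF" unfolding fool1_def by (intro Max_in) auto
    then obtain F where F: "one_fooling_set X Y f F" "fool1 X Y f = card F" by auto
    have "finite F" using F(1) assms unfolding one_fooling_set_def
      by (meson finite_SigmaI finite_subset)
    from card_fooling_set[OF F(1) this P]
    have "log 2 (real (fool1 X Y f)) \<le> log 2 (2 ^ (4 * q + 2))"
      using False F(2) by (intro log_mono) auto
    also have "\<dots> = real (4 * q + 2)" by (rule log_pow_cancel) auto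
    finally have "log 2 (real (fool1 X Y f)) \<le> real (4 * q + 2)" .
    thus ?thesis using False by (simp add: q log2_ereal_def)
  qed
qed

end
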